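(* Let $g_1,\ldots,g_m\colon\mathbb{R}^n\to\mathbb{R}$ be continuously differentiable, let $G(x)$ be the diagonal matrix with diagonal entries $g_1(x),\ldots,g_m(x)$ for every $x\in\mathbb{R}^n$, and let $\bar{x}\in\mathbb{R}^n$ satisfy $G(\bar{x})\succeq0$. Then $\bar{x}$ satisfies weak-nondegeneracy (for the constraint $G(x)\succeq 0$) if, and only if, the family $\{\nabla g_i(\bar{x}) : i\in\{1,\ldots,m\},\ g_i(\bar{x})=0\}$ is linearly independent.
   Context: $\mathbb{S}^m$ is the space of real symmetric $m\times m$ matrices; $M\succeq 0$ means that $M$ is positive semidefinite. For a continuously differentiable $G\colon\mathbb{R}^n\to\mathbb{S}^m$, let $D_{x_\ell}G(x)\in\mathbb{S}^m$ denote its partial derivatives. For $\bar{x}$ with $G(\bar{x})\succeq0$, $r=\operatorname{rank}(G(\bar{x}))$ and a matrix $\bar{E}\in\mathbb{R}^{m\times(m-r)}$ with columns $\bar{e}_1,\ldots,\bar{e}_{m-r}$, set $v_{ij}(\bar{x},\bar{E})=[\bar{e}_i^\top D_{x_1}G(\bar{x})\bar{e}_j,\ldots,\bar{e}_i^\top D_{x_n}G(\bar{x})\bar{e}_j]^\top\in\mathbb{R}^n$. Weak-nondegeneracy holds at $\bar{x}$ if either $\operatorname{Ker}G(\bar{x})=\{0\}$ or: for every sequence $\{x^k\}_{k\in\mathbb{N}}\to\bar{x}$ there exists a sequence of matrices with orthonormal columns $\{E^k\}_{k\in\mathbb{N}}\subseteq\mathbb{R}^{m\times(m-r)}$ such that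 (1) the columns of $E^k$ are eigenvectors associated with the $m-r$ smallest eigenvalues (counted with multiplicity) of $G(x^k)$, for each $k\in\mathbb{N}$; and (2) there exists a limit point (i.e. the limit of some subsequence) $\bar{E}$ of $\{E^k\}$ such that the family $\{v_{ii}(\bar{x},\bar{E}) : i\in\{1,\ldots,m-r\}\}$ is linearly independent. Linear independence is understood for indexed families (repetitions count), and the empty family is linearly independent. *)

theory Defs
  imports "HOL-Analysis.Analysis" "HOL-Computational_Algebra.Polynomial"
begin

definition continuously_differentiable ::
    "('a::real_normed_vector \<Rightarrow> 'b::real_normed_vector) \<Rightarrow> bool" where
  "continuously_differentiable f \<longleftrightarrow>
     (\<exists>f' :: 'a \<Rightarrow> 'a \<Rightarrow>\<^sub>L 'b.
        (\<forall>x. (f has_derivative blinfun_apply (f' x)) (at x)) \<and> continuous_on UNIV f')"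

definition gradient :: "('a::real_inner \<Rightarrow> real) \<Rightarrow> 'a \<Rightarrow> 'a" where
  "gradient f x = (THE D. GDERIV f x :> D)"

definition partial_deriv ::
    "'n \<Rightarrow> (real^'n \<Rightarrow> 'b::real_normed_vector) \<Rightarrow> real^'n \<Rightarrow> 'b" where
  "partial_deriv l f x = vector_derivative (\<lambda>t. f (x + t *\<^sub>R axis l 1)) (at 0)"

definition psd :: "real^'m^'m \<Rightarrow> bool" where
  "psd A \<longleftrightarrow> transpose A = A \<and> (\<forall>v. 0 \<le> v \<bullet> (A *v v))"

definition diagonal_matrix :: "('m \<Rightarrow> real) \<Rightarrow> real^'m^'m" where
  "diagonal_matrix d = (\<chi> i j. if i = j then d i else 0)"

definition charpoly :: "real^'m^'m \<Rightarrow> real poly" where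
  "charpoly A = det (mat [:0, 1:] - (\<chi> i j. [:A $ i $ j:]))"

text \<open>The real eigenvalues in ascending order, repeated according to multiplicity; for a
  symmetric matrix the list has length \<open>m\<close>, since all roots of its characteristic polynomial
  are real, and algebraic and geometric multiplicities agree.\<close>

definition eigenvalue_list :: "real^'m^'m \<Rightarrow> real list" where
  "eigenvalue_list A = sorted_list_of_multiset (proots (charpoly A))"

text \<open>A matrix with \<open>d\<close> columns in \<open>m\<close>-dimensional space is represented by its columns
  \<open>E 0, \<dots>, E (d - 1)\<close>, because \<open>d\<close> will be the value-dependent number \<open>m - r\<close>. Values of \<open>E\<close> at
  larger indices are irrelevant in everything below.\<close>

definition orthonormal_columns :: "nat \<Rightarrow> (nat \<Rightarrow> real^'m) \<Rightarrow> bool" where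
  "orthonormal_columns d E \<longleftrightarrow> (\<forall>i<d. \<forall>j<d. E i \<bullet> E j = (if i = j then 1 else 0))"

text \<open>No order of the columns is prescribed: the eigenvalues to which they belong are, as a
  multiset, the \<open>d\<close> smallest ones.\<close>

definition smallest_eigenvectors :: "nat \<Rightarrow> real^'m^'m \<Rightarrow> (nat \<Rightarrow> real^'m) \<Rightarrow> bool" where
  "smallest_eigenvectors d A E \<longleftrightarrow>
     (\<exists>\<mu> :: nat \<Rightarrow> real.
        mset (map \<mu> [0..<d]) = mset (take d (eigenvalue_list A)) \<and>
        (\<forall>i<d. E i \<noteq> 0 \<and> A *v E i = \<mu> i *\<^sub>R E i))"

definition limit_point_columns ::
    "nat \<Rightarrow> (nat \<Rightarrow> nat \<Rightarrow> real^'m) \<Rightarrow> (nat \<Rightarrow> real^'m) \<Rightarrow> bool" where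
  "limit_point_columns d Es E \<longleftrightarrow>
     (\<exists>\<phi> :: nat \<Rightarrow> nat. strict_mono \<phi> \<and> (\<forall>i<d. (\<lambda>k. Es (\<phi> k) i) \<longlonglongrightarrow> E i))"

text \<open>Injectivity makes this linear independence of an indexed family, where repetitions count.\<close>

definition independent_indexed :: "('i \<Rightarrow> 'a::real_vector) \<Rightarrow> 'i set \<Rightarrow> bool" where
  "independent_indexed v I \<longleftrightarrow> inj_on v I \<and> independent (v ` I)"

definition v_vec ::
    "(real^'n \<Rightarrow> real^'m^'m) \<Rightarrow> real^'n \<Rightarrow> (nat \<Rightarrow> real^'m) \<Rightarrow> nat \<Rightarrow> nat \<Rightarrow> real^'n" where
  "v_vec G x E i j = (\<chi> l. E i \<bullet> (partial_deriv l G x *v E j))"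

definition weak_nondegeneracy :: "(real^'n \<Rightarrow> real^'m^'m) \<Rightarrow> real^'n \<Rightarrow> bool" where
  "weak_nondegeneracy G x \<longleftrightarrow>
     {v. G x *v v = 0} = {0} \<or>
     (let d = CARD('m) - rank (G x) in
       \<forall>xs :: nat \<Rightarrow> real^'n. xs \<longlonglongrightarrow> x \<longrightarrow>
         (\<exists>Es :: nat \<Rightarrow> nat \<Rightarrow> real^'m.
            (\<forall>k. orthonormal_columns d (Es k)) \<and>
            (\<forall>k. smallest_eigenvectors d (G (xs k)) (Es k)) \<and>
            (\<exists>E. limit_point_columns d Es E \<and>
                 independent_indexed (\<lambda>i. v_vec G x E i i) {..<d})))"

end

(* For the forward direction it suffices to test weak-nondegeneracy along the constant sequence
   x^k = xbar: the eigenvectors then lie in Ker G(xbar), which is spanned by the coordinate vectors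
   of the active indices, so each v_ii is a combination of the active gradients with coefficients
   (E_i)_j^2.  These are d independent vectors in the span of d vectors.  Conversely, coordinate
   vectors can be used as eigenvectors; near xbar the active entries are the d smallest ones, so
   the sequence E^k can be taken to be eventually constant, and then the v_ii are the active
   gradients themselves. *)
theory Submission
  imports Defs
begin

section \<open>Spectrum and rank of diagonal matrices\<close>

lemma charpoly_diagonal_matrix:
  "charpoly (diagonal_matrix h) = (\<Prod>i\<in>UNIV. [:- h i, 1:])"
proof -
  let ?M = "mat [:0, 1:] - (\<chi> i j. [:diagonal_matrix h $ i $ j:]) :: real poly^'a^'a"
  have "det ?M = (\<Prod>i\<in>UNIV. ?M $ i $ i)"
    by (rule det_diagonal) (simp add: mat_def diagonal_matrix_def)
  then show ?thesis
    by (simp add: charpoly_def mat_def diagonal_matrix_def)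
qed

lemma eigenvalue_list_diagonal_matrix:
  "eigenvalue_list (diagonal_matrix h) =
    sorted_list_of_multiset (image_mset h (mset_set UNIV))"
proof -
  have "proots (charpoly (diagonal_matrix h)) = (\<Sum>i\<in>UNIV. {#h i#})"
    unfolding charpoly_diagonal_matrix by (subst proots_prod) auto
  also have "\<dots> = image_mset h (mset_set UNIV)"
    by (simp add: sum_unfold_sum_mset)
  finally show ?thesis
    by (simp add: eigenvalue_list_def)
qed

lemma diagonal_matrix_mult_nth: "(diagonal_matrix h *v x) $ i = h i * x $ i"
  by (simp add: matrix_vector_mult_def diagonal_matrix_def if_distrib[of "\<lambda>a. a * _"] cong: if_cong)

lemma rank_diagonal_matrix:
  "rank (diagonal_matrix h :: real^'m^'m) = card {i. h i \<noteq> 0}"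
proof -
  have "range (\<lambda>x. diagonal_matrix h *v x) = {x::real^'m. \<forall>i. i \<notin> {i. h i \<noteq> 0} \<longrightarrow> x $ i = 0}"
  proof (intro equalityI subsetI)
    fix x :: "real^'m"
    assume "x \<in> {x. \<forall>i. i \<notin> {i. h i \<noteq> 0} \<longrightarrow> x $ i = 0}"
    \<comment> \<open>Dividing by the diagonal entries gives a preimage; where
      \<open>h i = 0\<close> the quotient is 0 by convention, which fits because
      \<open>x $ i = 0\<close> there.\<close>
    then have "x = diagonal_matrix h *v (\<chi> i. x $ i / h i)"
      by (auto simp: vec_eq_iff diagonal_matrix_mult_nth)
    then show "x \<in> range (\<lambda>x. diagonal_matrix h *v x)" by blast
  qed (auto simp: diagonal_matrix_mult_nth)
  then show ?thesis
    by (simp only: rank_dim_range dim_vec_eq[symmetric] dim_substandard_cart)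
qed

text \<open>Identifies the number m - r of columns in weak-nondegeneracy with the number of active
  constraints.\<close>

lemma card_minus_rank_diagonal_matrix:
  "CARD('m) - rank (diagonal_matrix h :: real^'m^'m) = card {i. h i = 0}"
proof -
  have "card {i. h i = 0} + card {i. h i \<noteq> 0} = card ({i. h i = 0} \<union> {i. h i \<noteq> 0})"
    by (rule card_Un_disjoint[symmetric]) auto
  also have "{i. h i = 0} \<union> {i. h i \<noteq> 0} = UNIV" by auto
  finally show ?thesis by (simp add: rank_diagonal_matrix)
qed

section \<open>The smallest eigenvalues of a diagonal matrix and their eigenvectors\<close>

lemma take_sorted_list_of_multiset_add:
  assumes "\<And>a b. a \<in># A \<Longrightarrow> b \<in># B \<Longrightarrow> a \<le> b"
  shows "take (size A) (sorted_list_of_multiset (A + B)) = sorted_list_of_multiset A"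
proof -
  let ?xs = "sorted_list_of_multiset A" and ?ys = "sorted_list_of_multiset B"
  \<comment> \<open>Both lists are sorted and no entry of the first exceeds an entry of the second,
    so sorting leaves the concatenation unchanged.\<close>
  have "sort (?xs @ ?ys) = ?xs @ ?ys"
    by (rule properties_for_sort) (auto simp: sorted_append assms)
  moreover have "sorted_list_of_multiset (A + B) = sort (?xs @ ?ys)"
    by (metis mset_append mset_sorted_list_of_multiset sorted_list_of_multiset_mset)
  moreover have "length ?xs = size A"
    by (metis mset_sorted_list_of_multiset size_mset)
  ultimately show ?thesis by simp
qed

text \<open>The entries over \<open>S\<close> lie below those over its complement, so the sorted
  spectrum begins with them. Ties across the split are harmless, since only the multiset of values
  matters.\<close>

lemma mset_take_eigenvalue_list_diagonal_matrix:
  assumes "\<And>i j. i \<in> S \<Longrightarrow> j \<notin> S \<Longrightarrow> h i \<le> h j"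
  shows "mset (take (card S) (eigenvalue_list (diagonal_matrix h))) = image_mset h (mset_set S)"
proof -
  have "mset_set UNIV = mset_set S + mset_set (- S)"
    by (metis Compl_disjoint Compl_partition finite mset_set_Union)
  then have "eigenvalue_list (diagonal_matrix h) =
      sorted_list_of_multiset (image_mset h (mset_set S) + image_mset h (mset_set (- S)))"
    by (simp add: eigenvalue_list_diagonal_matrix)
  moreover have "take (size (image_mset h (mset_set S))) \<dots> =
      sorted_list_of_multiset (image_mset h (mset_set S))"
    by (rule take_sorted_list_of_multiset_add) (auto intro: assms)
  ultimately show ?thesis by simp
qed

text \<open>The eigenvalue belonging to the column \<open>axis (s i) 1\<close> is
  \<open>h (s i)\<close>. Injectivity of \<open>s\<close> ensures that these values occur with the
  right multiplicities.\<close>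

lemma smallest_eigenvectors_axis:
  assumes inj: "inj_on s {..<d}"
    and le: "\<And>i j. i < d \<Longrightarrow> j \<notin> s ` {..<d} \<Longrightarrow> h (s i) \<le> h j"
  shows "smallest_eigenvectors d (diagonal_matrix h) (\<lambda>i. axis (s i) 1)"
proof -
  have "mset (take (card (s ` {..<d})) (eigenvalue_list (diagonal_matrix h))) =
      image_mset h (mset_set (s ` {..<d}))"
    by (rule mset_take_eigenvalue_list_diagonal_matrix) (auto intro: le)
  also have "mset_set (s ` {..<d}) = image_mset s (mset_set {..<d})"
    using inj by (simp add: image_mset_mset_set)
  finally have "mset (map (\<lambda>i. h (s i)) [0..<d]) = mset (take d (eigenvalue_list (diagonal_matrix h)))"
    using inj by (simp add: card_image image_mset.compositionality comp_def atLeast0LessThan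
        flip: mset_set_upto_eq_mset_upto)
  moreover have "diagonal_matrix h *v axis (s i) 1 = h (s i) *\<^sub>R axis (s i) 1" for i
    by (simp add: vec_eq_iff diagonal_matrix_mult_nth axis_def)
  ultimately show ?thesis
    unfolding smallest_eigenvectors_def by (intro exI[of _ "\<lambda>i. h (s i)"]) (auto simp: axis_eq_0_iff)
qed

lemma orthonormal_columns_axis:
  "inj_on s {..<d} \<Longrightarrow> orthonormal_columns d (\<lambda>i. axis (s i) 1)"
  by (auto simp: orthonormal_columns_def inner_axis_axis inj_on_eq_iff)

text \<open>Sorting the coordinates by their diagonal entries and keeping the first \<open>d\<close>
  coordinate vectors gives an admissible choice. It serves those members of a sequence at which the
  active entries need not be the smallest.\<close>

lemma ex_smallest_eigenvectors_diagonal_matrix: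
  fixes h :: "'m::finite \<Rightarrow> real"
  assumes "d \<le> CARD('m)"
  obtains E where "orthonormal_columns d E" "smallest_eigenvectors d (diagonal_matrix h) E"
proof -
  obtain xs :: "'m list" where xs: "set xs = UNIV" "distinct xs"
    using finite_distinct_list[OF finite[of "UNIV :: 'm set"]] by blast
  define ys where "ys = sort_key h xs"
  have ys: "set ys = UNIV" "distinct ys" "sorted (map h ys)"
    using xs by (auto simp: ys_def)
  have len: "length ys = CARD('m)"
    using ys distinct_card by metis
  have inj: "inj_on ((!) ys) {..<d}"
    using ys len assms by (auto simp: inj_on_def nth_eq_iff_index_eq)
  have le: "h (ys ! i) \<le> h j" if i: "i < d" and j: "j \<notin> (!) ys ` {..<d}" for i j
  proof -
    obtain k where k: "k < length ys" "j = ys ! k"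
      using ys(1) by (metis UNIV_I in_set_conv_nth)
    with j have "d \<le> k" by (metis image_eqI lessThan_iff not_le)
    with sorted_nth_mono[OF ys(3), of i k] i k show ?thesis by simp
  qed
  show thesis
    using that orthonormal_columns_axis[OF inj] smallest_eigenvectors_axis[where h = h, OF inj le] by blast
qed

section \<open>Gradients, partial derivatives and the vectors v_ij\<close>

lemma GDERIV_gradient:
  fixes f :: "'a::euclidean_space \<Rightarrow> real"
  assumes "continuously_differentiable f"
  shows "GDERIV f x :> gradient f x"
proof -
  obtain f' where "(f has_derivative blinfun_apply f') (at x)"
    using assms unfolding continuously_differentiable_def by blast
  \<comment> \<open>Riesz representation: the derivative is the inner product with the vector of its
    values on the basis.\<close>
  moreover have "blinfun_apply f' h = h \<bullet> (\<Sum>b\<in>Basis. blinfun_apply f' b *\<^sub>R b)" for h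
  proof -
    have "blinfun_apply f' h = blinfun_apply f' (\<Sum>b\<in>Basis. (h \<bullet> b) *\<^sub>R b)"
      by (simp add: euclidean_representation)
    also have "\<dots> = (\<Sum>b\<in>Basis. (h \<bullet> b) * blinfun_apply f' b)"
      by (simp add: blinfun.sum_right blinfun.scaleR_right)
    finally show ?thesis by (simp add: inner_sum_right mult.commute)
  qed
  then have "blinfun_apply f' = (\<lambda>h. h \<bullet> (\<Sum>b\<in>Basis. blinfun_apply f' b *\<^sub>R b))" ..
  ultimately have ex: "GDERIV f x :> (\<Sum>b\<in>Basis. blinfun_apply f' b *\<^sub>R b)"
    by (simp add: gderiv_def)
  \<comment> \<open>Uniqueness is what gives the definite description in \<open>gradient\<close> its
    meaning.\<close>
  have "D = D'" if "GDERIV f x :> D" "GDERIV f x :> D'" for D D'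
    using has_derivative_unique[OF that[unfolded gderiv_def]]
    by (metis inner_commute vector_eq_rdot)
  then show ?thesis
    unfolding gradient_def using ex by (blast intro: theI)
qed

lemma partial_deriv_diagonal_matrix:
  fixes g :: "'m::finite \<Rightarrow> real^'n \<Rightarrow> real"
  assumes "\<And>i. GDERIV (g i) x :> D i"
  shows "partial_deriv l (\<lambda>x. diagonal_matrix (\<lambda>i. g i x)) x =
    (diagonal_matrix (\<lambda>i. D i $ l) :: real^'m^'m)"
proof -
  have entry: "((\<lambda>t. g i (x + t *\<^sub>R axis l 1)) has_real_derivative D i $ l) (at 0)" for i
  proof -
    have 1: "((\<lambda>t. x + t *\<^sub>R axis l 1) has_derivative (\<lambda>t. t *\<^sub>R axis l 1)) (at (0::real))"
      by (auto intro!: derivative_eq_intros)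
    have 2: "(g i has_derivative (\<lambda>h. h \<bullet> D i)) (at (x + (0::real) *\<^sub>R axis l 1))"
      using assms[of i] by (simp add: gderiv_def)
    show ?thesis
      using has_derivative_compose[OF 1 2]
      by (simp add: has_field_derivative_def inner_axis' mult_commute_abs)
  qed
  \<comment> \<open>Expanding in the constant matrices with a single diagonal 1 reduces the matrix
    derivative to scalar derivatives of the entries.\<close>
  let ?e = "\<lambda>i. diagonal_matrix (\<lambda>j. if j = i then 1 else 0) :: real^'m^'m"
  have sum: "diagonal_matrix h = (\<Sum>i\<in>UNIV. h i *\<^sub>R ?e i)" for h :: "'m \<Rightarrow> real"
    by (simp add: vec_eq_iff diagonal_matrix_def if_distrib[of "(*) _"] cong: if_cong)
  have "((\<lambda>t. \<Sum>i\<in>UNIV. g i (x + t *\<^sub>R axis l 1) *\<^sub>R ?e i) has_vector_derivative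
      (\<Sum>i\<in>UNIV. D i $ l *\<^sub>R ?e i)) (at 0)"
  proof (rule has_vector_derivative_sum)
    fix i
    show "((\<lambda>t. g i (x + t *\<^sub>R axis l 1) *\<^sub>R ?e i) has_vector_derivative D i $ l *\<^sub>R ?e i) (at 0)"
      using has_vector_derivative_scaleR[OF entry[of i] has_vector_derivative_const[of "?e i"]] by simp
  qed
  then have "((\<lambda>t. diagonal_matrix (\<lambda>i. g i (x + t *\<^sub>R axis l 1))) has_vector_derivative
      diagonal_matrix (\<lambda>i. D i $ l)) (at 0)"
    by (simp flip: sum)
  then show ?thesis
    unfolding partial_deriv_def by (rule vector_derivative_at)
qed

text \<open>All partial derivatives of \<open>G\<close> are diagonal, so the bilinear form has no
  mixed terms; for \<open>i = j\<close> the weights are the squares of the coordinates of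
  \<open>E i\<close>.\<close>

lemma v_vec_diagonal_matrix:
  assumes "\<And>i. GDERIV (g i) x :> D i"
  shows "v_vec (\<lambda>x. diagonal_matrix (\<lambda>i. g i x)) x E i j = (\<Sum>p\<in>UNIV. (E i $ p * E j $ p) *\<^sub>R D p)"
  unfolding v_vec_def partial_deriv_diagonal_matrix[OF assms]
  by (simp add: vec_eq_iff inner_vec_def diagonal_matrix_mult_nth mult.assoc mult.left_commute
      mult.commute)

section \<open>Linear independence of indexed families\<close>

lemma independent_indexed_reindex:
  assumes "independent_indexed w I" "bij_betw s J I"
  shows "independent_indexed (\<lambda>j. w (s j)) J"
  using assms unfolding independent_indexed_def bij_betw_def
  by (metis (no_types, lifting) comp_inj_on image_comp comp_def inj_on_cong image_cong)

text \<open>In the chain card I \<le> card J \<le> dim (span (w \<open>I)) \<le> card (w\<close> I)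
  \<le> card I equality must hold throughout. This forces \<open>w\<close> to be injective on
  \<open>I\<close> and its image to be independent.\<close>

lemma independent_indexed_if_in_span:
  fixes w :: "'i \<Rightarrow> 'a::euclidean_space"
  assumes v: "independent_indexed v J" and sub: "v ` J \<subseteq> span (w ` I)"
    and fin: "finite I" and card: "card I \<le> card J"
  shows "independent_indexed w I"
proof -
  have "card I \<le> card (v ` J)"
    using v card by (simp add: independent_indexed_def card_image)
  also have "\<dots> \<le> dim (span (w ` I))"
    using v sub by (intro independent_card_le_dim) (auto simp: independent_indexed_def)
  finally have le: "card I \<le> dim (w ` I)" by simp
  moreover have "dim (w ` I) \<le> card (w ` I)"
    using fin by (simp add: dim_le_card')
  ultimately have "inj_on w I"
    using fin card_image_le[OF fin, of w] by (intro eq_card_imp_inj_on) auto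
  moreover have "independent (w ` I)"
    using fin le card_image_le[OF fin, of w]
    by (intro card_le_dim_spanning[where V = "w ` I"]) (auto intro: span_base)
  ultimately show ?thesis by (simp add: independent_indexed_def)
qed

section \<open>The two implications\<close>

lemma smallest_eigenvectors_in_kernel:
  assumes nonneg: "\<And>i. 0 \<le> h i"
    and E: "smallest_eigenvectors (card {i. h i = 0}) (diagonal_matrix h) E"
    and i: "i < card {i. h i = 0}" and p: "h p \<noteq> 0"
  shows "E i $ p = 0"
proof -
  let ?d = "card {i. h i = 0}"
  obtain \<mu> where \<mu>: "mset (map \<mu> [0..<?d]) = mset (take ?d (eigenvalue_list (diagonal_matrix h)))"
    and ev: "\<And>i. i < ?d \<Longrightarrow> diagonal_matrix h *v E i = \<mu> i *\<^sub>R E i"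
    using E unfolding smallest_eigenvectors_def by blast
  \<comment> \<open>Since no entry is negative, the zero entries are the smallest ones, so every
    prescribed eigenvalue is 0 and the columns lie in the kernel.\<close>
  have "\<mu> i \<in># mset (map \<mu> [0..<?d])" using i by simp
  also have "mset (map \<mu> [0..<?d]) = image_mset h (mset_set {i. h i = 0})"
    unfolding \<mu> by (rule mset_take_eigenvalue_list_diagonal_matrix) (use nonneg in auto)
  finally have "\<mu> i = 0" by auto
  then have "(diagonal_matrix h *v E i) $ p = 0" using ev[OF i] by simp
  then show ?thesis using p by (simp add: diagonal_matrix_mult_nth)
qed

lemma independent_gradients_if_weak_nondegeneracy:
  fixes g :: "'m::finite \<Rightarrow> real^'n \<Rightarrow> real"
  assumes D: "\<And>i. GDERIV (g i) x :> D i"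
    and nonneg: "\<And>i. 0 \<le> g i x"
    and wnd: "weak_nondegeneracy (\<lambda>x. diagonal_matrix (\<lambda>i. g i x) :: real^'m^'m) x"
  shows "independent_indexed D {i. g i x = 0}"
\<comment> \<open>Without active indices the kernel is trivial and the first alternative of
  weak-nondegeneracy holds, so this case is settled separately by the empty family.\<close>
proof (cases "{i. g i x = 0} = {}")
  case True
  then show ?thesis by (simp add: independent_indexed_def independent_empty)
next
  case False
  define G :: "real^'n \<Rightarrow> real^'m^'m" where "G = (\<lambda>x. diagonal_matrix (\<lambda>i. g i x))"
  define I where "I = {i. g i x = 0}"
  \<comment> \<open>An active index supplies a nonzero kernel vector, which excludes the first
    alternative.\<close>
  obtain i where "g i x = 0" using False by auto
  then have "G x *v axis i 1 = 0"
    by (auto simp: G_def vec_eq_iff diagonal_matrix_mult_nth axis_def)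
  moreover have "axis i 1 \<noteq> (0 :: real^'m)" by (simp add: axis_eq_0_iff)
  ultimately have "{v. G x *v v = 0} \<noteq> {0}" by blast
  moreover have "CARD('m) - rank (G x) = card I"
    by (simp add: G_def I_def card_minus_rank_diagonal_matrix)
  moreover have "(\<lambda>_. x) \<longlonglongrightarrow> x" by simp
  ultimately obtain Es E
    where sm: "\<And>k. smallest_eigenvectors (card I) (G x) (Es k)"
      and lp: "limit_point_columns (card I) Es E"
      and ind: "independent_indexed (\<lambda>i. v_vec G x E i i) {..<card I}"
    using wnd unfolding weak_nondegeneracy_def G_def[symmetric] Let_def by metis
  obtain f where lim: "\<And>i. i < card I \<Longrightarrow> (\<lambda>k. Es (f k) i) \<longlonglongrightarrow> E i"
    using lp unfolding limit_point_columns_def by blast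
  \<comment> \<open>Vanishing of the inactive coordinates passes from the kernel vectors
    \<open>Es k i\<close> to the limit.\<close>
  have E0: "E i $ p = 0" if "i < card I" "p \<notin> I" for i p
  proof -
    have "Es k i $ p = 0" for k
      using smallest_eigenvectors_in_kernel[of "\<lambda>i. g i x" "Es k" i p] nonneg sm[of k] that
      by (simp add: G_def I_def)
    with tendsto_vec_nth[OF lim[OF that(1)], of p] show ?thesis
      by (simp add: LIMSEQ_const_iff)
  qed
  have "v_vec G x E i i \<in> span (D ` I)" if "i < card I" for i
  proof -
    have "(E i $ p * E i $ p) *\<^sub>R D p \<in> span (D ` I)" for p
      using E0[OF that, of p] by (cases "p \<in> I") (auto intro: span_scale span_base span_zero)
    then show ?thesis
      unfolding G_def v_vec_diagonal_matrix[OF D] by (intro span_sum)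
  qed
  then have "independent_indexed D I"
    by (intro independent_indexed_if_in_span[OF ind]) auto
  then show ?thesis by (simp add: I_def)
qed

text \<open>The second alternative of the definition is established in all cases; with no active
  index it holds with \<open>d = 0\<close> columns.\<close>

lemma weak_nondegeneracy_if_independent_gradients:
  fixes g :: "'m::finite \<Rightarrow> real^'n \<Rightarrow> real"
  assumes D: "\<And>i. GDERIV (g i) x :> D i"
    and nonneg: "\<And>i. 0 \<le> g i x"
    and ind: "independent_indexed D {i. g i x = 0}"
  shows "weak_nondegeneracy (\<lambda>x. diagonal_matrix (\<lambda>i. g i x) :: real^'m^'m) x"
proof -
  define G :: "real^'n \<Rightarrow> real^'m^'m" where "G = (\<lambda>x. diagonal_matrix (\<lambda>i. g i x))"
  define I where "I = {i. g i x = 0}"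
  define d where "d = card I"
  have d: "CARD('m) - rank (G x) = d"
    by (simp add: G_def I_def d_def card_minus_rank_diagonal_matrix)
  obtain s where s: "bij_betw s {..<d} I"
    using ex_bij_betw_nat_finite[of I] by (auto simp: d_def atLeast0LessThan)
  define E :: "nat \<Rightarrow> real^'m" where "E = (\<lambda>i. axis (s i) 1)"
  have inj: "inj_on s {..<d}" using s by (simp add: bij_betw_def)
  have img: "s ` {..<d} = I" using s by (simp add: bij_betw_def)
  have orth: "orthonormal_columns d E"
    unfolding E_def by (rule orthonormal_columns_axis[OF inj])
  \<comment> \<open>For a coordinate vector the squared weights single out the gradient with index
    \<open>s i\<close>.\<close>
  have "(E i $ p * E i $ p) *\<^sub>R D p = (if p = s i then D p else 0)" for i p
    by (simp add: E_def axis_def)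
  then have "v_vec G x E i i = D (s i)" for i
    unfolding G_def v_vec_diagonal_matrix[OF D] by simp
  then have indv: "independent_indexed (\<lambda>i. v_vec G x E i i) {..<d}"
    using independent_indexed_reindex[OF ind[folded I_def] s] by simp
  have "\<exists>Es. (\<forall>k. orthonormal_columns d (Es k)) \<and> (\<forall>k. smallest_eigenvectors d (G (xs k)) (Es k)) \<and>
      (\<exists>E. limit_point_columns d Es E \<and> independent_indexed (\<lambda>i. v_vec G x E i i) {..<d})"
    if xs: "xs \<longlonglongrightarrow> x" for xs
  proof -
    have lim: "(\<lambda>k. g i (xs k)) \<longlonglongrightarrow> g i x" for i
    proof (rule isCont_tendsto_compose[OF _ xs])
      show "isCont (g i) x"
        using D[of i] unfolding gderiv_def by (rule has_derivative_continuous)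
    qed
    \<comment> \<open>Active values tend to 0 and inactive ones to positive limits, so they are
      eventually separated; finiteness of the index sets then makes this uniform over all
      pairs.\<close>
    have "\<forall>\<^sub>F k in sequentially. g i (xs k) < g j (xs k)" if "i \<in> I" "j \<notin> I" for i j
    proof -
      have "(\<lambda>k. g j (xs k) - g i (xs k)) \<longlonglongrightarrow> g j x - g i x"
        by (intro tendsto_diff lim)
      moreover have "0 < g j x - g i x"
        using that nonneg[of j] by (simp add: I_def)
      ultimately have "\<forall>\<^sub>F k in sequentially. 0 < g j (xs k) - g i (xs k)"
        by (rule order_tendstoD(1))
      then show ?thesis by simp
    qed
    then have "\<forall>\<^sub>F k in sequentially. \<forall>i\<in>I. \<forall>j\<in>-I. g i (xs k) < g j (xs k)"
      by (intro eventually_ball_finite ballI) auto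
    then have ev: "\<forall>\<^sub>F k in sequentially. smallest_eigenvectors d (G (xs k)) E"
    proof eventually_elim
      case (elim k)
      show ?case
        unfolding G_def E_def
        by (rule smallest_eigenvectors_axis[OF inj]) (use elim img in \<open>force intro: less_imp_le\<close>)
    qed
    \<comment> \<open>The conditions on the columns are imposed for every \<open>k\<close>, so the
      finitely many members where \<open>E\<close> may fail receive some other admissible choice.
      This leaves the limit \<open>E\<close> unaffected.\<close>
    define Es where "Es = (\<lambda>k. if smallest_eigenvectors d (G (xs k)) E then E
      else SOME E. orthonormal_columns d E \<and> smallest_eigenvectors d (G (xs k)) E)"
    have "d \<le> CARD('m)" using d by linarith
    then have "\<exists>E. orthonormal_columns d E \<and> smallest_eigenvectors d (G (xs k)) E" for k
      unfolding G_def using ex_smallest_eigenvectors_diagonal_matrix by metis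
    then have "orthonormal_columns d (Es k) \<and> smallest_eigenvectors d (G (xs k)) (Es k)" for k
      using orth someI_ex[of "\<lambda>E. orthonormal_columns d E \<and> smallest_eigenvectors d (G (xs k)) E"]
      by (simp add: Es_def)
    moreover have "(\<lambda>k. Es k i) \<longlonglongrightarrow> E i" for i
      by (rule tendsto_eventually, rule eventually_mono[OF ev]) (simp add: Es_def)
    then have "limit_point_columns d Es E"
      unfolding limit_point_columns_def by (intro exI[of _ id]) (simp add: strict_mono_def)
    ultimately show ?thesis using indv by blast
  qed
  then show ?thesis
    unfolding weak_nondegeneracy_def G_def[symmetric] Let_def d by blast
qed

theorem mainTheorem3:
  fixes g :: "'m::finite \<Rightarrow> real^'n \<Rightarrow> real"
    and G :: "real^'n \<Rightarrow> real^'m^'m"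
    and xbar :: "real^'n"
  assumes "\<And>i. continuously_differentiable (g i)"
    and "\<And>x. G x = diagonal_matrix (\<lambda>i. g i x)"
    and "psd (G xbar)"
  shows "weak_nondegeneracy G xbar \<longleftrightarrow>
         independent_indexed (\<lambda>i. gradient (g i) xbar) {i. g i xbar = 0}"
proof -
  have G: "G = (\<lambda>x. diagonal_matrix (\<lambda>i. g i x))" using assms(2) by blast
  have D: "GDERIV (g i) xbar :> gradient (g i) xbar" for i
    by (rule GDERIV_gradient[OF assms(1)])
  have nonneg: "0 \<le> g i xbar" for i
  proof -
    \<comment> \<open>Testing semidefiniteness on a coordinate vector isolates one diagonal
      entry.\<close>
    have "0 \<le> axis i 1 \<bullet> (G xbar *v axis i 1)" using assms(3) by (auto simp: psd_def)
    then show ?thesis by (simp add: G inner_axis' diagonal_matrix_mult_nth)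
  qed
  show ?thesis
    unfolding G
    using independent_gradients_if_weak_nondegeneracy[of g, OF D nonneg]
      weak_nondegeneracy_if_independent_gradients[of g, OF D nonneg] by blast
qed

end
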